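(* Let $A$ be an irreducible, nonnegative symmetric $n\times n$ matrix and let $\mathcal{P}$ be a partition of $[n]$ such that $\mathcal{P}\times\mathcal{P}$ is equitable for $A$. Then $\mu_1(A)=\mu_1(A|\mathcal{P}\times\mathcal{P})$.
   Context: $[n]=\{1,\ldots,n\}$; partitions consist of nonempty sets. For a Hermitian matrix $M$, $\mu_1(M)$ denotes its largest eigenvalue. For a matrix $A=\{a_{ij}\}$ of size $m\times n$ and $I\subset[m]$, $J\subset[n]$, $A[I,J]$ is the submatrix of all $a_{ij}$ with $i\in I$, $j\in J$. A matrix is called regular if all its row sums are equal and all its column sums are equal. For partitions $\mathcal{P}=\{P_1,\ldots,P_k\}$ of $[m]$ and $\mathcal{Q}=\{Q_1,\ldots,Q_l\}$ of $[n]$, $\mathcal{P}\times\mathcal{Q}=\{P_i\times Q_j: i\in[k], j\in[l]\}$ is called equitable for $A$ if $A[P_p,Q_q]$ is regular for all $p\in[k]$, $q\in[l]$. $A|\mathcal{P}\times\mathcal{Q}$ denotes the $k\times l$ (quotient) matrix $\{b_{pq}\}$ with $$b_{pq}=\frac{1}{\sqrt{|P_p||Q_q|}}\sum_{i\in P_p,\,j\in Q_q}a_{ij}.$$ Here these notions are used with $m=n$ and $\mathcal{Q}=\mathcal{P}$. *)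

theory Defs
  imports
    "Jordan_Normal_Form.Char_Poly"
    "Jordan_Normal_Form.DL_Submatrix"
    "HOL-Combinatorics.Permutations"
    "HOL-Library.Disjoint_Sets"
begin

text \<open>Matrices are those of \<^theory>\<open>Jordan_Normal_Form.Matrix\<close>, with rows and columns
  indexed from 0, so \<open>[n]\<close> becomes \<open>{..<n}\<close>.\<close>

(* Meant for Hermitian matrices, whose eigenvalues are all real; the type variable covers
   real symmetric and complex Hermitian matrices alike. *)
definition largest_eigenvalue :: "'a :: real_field mat \<Rightarrow> real" where
  "largest_eigenvalue M = Max {x. eigenvalue M (of_real x)}"

(* Some simultaneous permutation of rows and columns produces a block triangular matrix with
   an r x (n - r) block of zeros, where 0 < r < n. In particular every 1 x 1 matrix, including
   the zero matrix, is irreducible. *)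
definition reducible_mat :: "'a :: zero mat \<Rightarrow> bool" where
  "reducible_mat A \<longleftrightarrow>
     (\<exists>\<pi> r. \<pi> permutes {..<dim_row A} \<and> 0 < r \<and> r < dim_row A \<and>
       (\<forall>i j. r \<le> i \<and> i < dim_row A \<and> j < r \<longrightarrow> A $$ (\<pi> i, \<pi> j) = 0))"

definition irreducible_mat :: "'a :: zero mat \<Rightarrow> bool" where
  "irreducible_mat A \<longleftrightarrow> square_mat A \<and> \<not> reducible_mat A"

definition nonneg_mat :: "real mat \<Rightarrow> bool" where
  "nonneg_mat A \<longleftrightarrow> (\<forall>i < dim_row A. \<forall>j < dim_col A. 0 \<le> A $$ (i, j))"

definition symmetric_mat :: "'a mat \<Rightarrow> bool" where
  "symmetric_mat A \<longleftrightarrow> transpose_mat A = A"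

definition regular_mat :: "'a :: comm_monoid_add mat \<Rightarrow> bool" where
  "regular_mat A \<longleftrightarrow>
     (\<exists>r. \<forall>i < dim_row A. (\<Sum>j < dim_col A. A $$ (i, j)) = r) \<and>
     (\<exists>c. \<forall>j < dim_col A. (\<Sum>i < dim_row A. A $$ (i, j)) = c)"

(* A partition is given with an enumeration of its parts, which fixes the order of the rows
   and columns of the quotient matrix. *)
definition is_partition :: "nat \<Rightarrow> nat set list \<Rightarrow> bool" where
  "is_partition n Ps \<longleftrightarrow> distinct Ps \<and> partition_on {..<n} (set Ps)"

definition equitable :: "'a :: comm_monoid_add mat \<Rightarrow> nat set list \<Rightarrow> nat set list \<Rightarrow> bool" where
  "equitable A Ps Qs \<longleftrightarrow> (\<forall>P \<in> set Ps. \<forall>Q \<in> set Qs. regular_mat (submatrix A P Q))"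

definition quotient_mat :: "'a :: real_vector mat \<Rightarrow> nat set list \<Rightarrow> nat set list \<Rightarrow> 'a mat" where
  "quotient_mat A Ps Qs = mat (length Ps) (length Qs) (\<lambda>(p, q).
     (1 / sqrt (real (card (Ps ! p) * card (Qs ! q)))) *\<^sub>R
     (\<Sum>i \<in> Ps ! p. \<Sum>j \<in> Qs ! q. A $$ (i, j)))"

end

theory Submission
  imports
    Defs
    "Jordan_Normal_Form.Spectral_Radius"
    "HOL-Analysis.Function_Topology"
begin

text \<open>
  Write \<open>B\<close> for the quotient \<open>A|P \<times> P\<close> and let \<open>C\<close> be the \<open>n \<times> k\<close> matrix whose columns are the
  indicator vectors of the parts, scaled to unit length. Equitability says that \<open>A\<close> maps
  the span of these columns into itself, and the normalisation of the quotient is chosen so that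
  \<open>B\<close> is the matrix of \<open>A\<close> in that orthonormal basis: \<open>A C = C B\<close>
  (\<open>equitable_intertwines\<close>).

  This identity is used in two ways. Since \<open>C\<close> is injective, an eigenvector \<open>y\<close> of \<open>B\<close> lifts to the
  eigenvector \<open>C y\<close> of \<open>A\<close> with the same eigenvalue, so every eigenvalue of \<open>B\<close> is one of \<open>A\<close>.
  Transposing, and using that \<open>A\<close> and \<open>B\<close> are symmetric, gives \<open>C\<^sup>T A = B C\<^sup>T\<close>; so an eigenvector \<open>x\<close>
  of \<open>A\<close> is sent to an eigenvector \<open>C\<^sup>T x\<close> of \<open>B\<close> as soon as \<open>C\<^sup>T x\<close> is nonzero. The entries of \<open>C\<^sup>T x\<close>
  are positive multiples of the sums of \<open>x\<close> over the parts, which cannot all vanish when \<open>x\<close> is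
  nonzero with nonnegative entries.

  It remains to find such an \<open>x\<close> for the largest eigenvalue of \<open>A\<close>, which is the easy half of the
  Perron-Frobenius theorem (\<open>symmetric_nonneg_mat_top_eigenvector\<close>). By compactness the quadratic
  form of \<open>A\<close> attains its maximum \<open>l\<close> over the unit sphere at some point \<open>z\<close>. Replacing the entries
  of \<open>z\<close> by their absolute values does not decrease the form, because \<open>A\<close> is nonnegative, so \<open>|z|\<close>
  is a maximiser too. Every maximiser is an eigenvector for \<open>l\<close>, and \<open>l\<close> bounds all eigenvalues of
  \<open>A\<close>.
\<close>

section \<open>Maximising a quadratic form over the unit sphere\<close>

definition bilin :: "'i set \<Rightarrow> ('i \<Rightarrow> 'i \<Rightarrow> real) \<Rightarrow> ('i \<Rightarrow> real) \<Rightarrow> ('i \<Rightarrow> real) \<Rightarrow> real" where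
  "bilin I a x y = (\<Sum>i\<in>I. \<Sum>j\<in>I. a i j * x i * y j)"

lemma bilin_eq_row: "bilin I a x y = (\<Sum>i\<in>I. x i * (\<Sum>j\<in>I. a i j * y j))"
  by (simp add: bilin_def sum_distrib_left mult_ac)

lemma bilin_commute:
  assumes "\<And>i j. i \<in> I \<Longrightarrow> j \<in> I \<Longrightarrow> a i j = a j i"
  shows "bilin I a x y = bilin I a y x"
  unfolding bilin_def
  by (subst sum.swap) (intro sum.cong refl, simp add: assms mult_ac)

lemma bilin_perturb:
  assumes "\<And>i j. i \<in> I \<Longrightarrow> j \<in> I \<Longrightarrow> a i j = a j i"
  shows "bilin I a (\<lambda>i. x i + t * y i) (\<lambda>i. x i + t * y i)
    = bilin I a x x + 2 * t * bilin I a y x + t\<^sup>2 * bilin I a y y"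
proof -
  have "bilin I a (\<lambda>i. x i + t * y i) (\<lambda>i. x i + t * y i)
      = bilin I a x x + t * bilin I a x y + t * bilin I a y x + t\<^sup>2 * bilin I a y y"
    by (simp add: bilin_def sum.distrib sum_distrib_left algebra_simps power2_eq_square)
  then show ?thesis
    using bilin_commute[of I a x y] assms by simp
qed

text \<open>Vectors indexed by \<open>I\<close> are represented by functions on the whole index type. The sphere of all
  such functions is in general not compact, as values outside \<open>I\<close> are arbitrary; restricted to the functions
  that vanish there, it is a closed subset of a product of compact intervals, hence compact by
  Tychonoff's theorem.\<close>

lemma quadratic_form_attains_max:
  fixes a :: "'i \<Rightarrow> 'i \<Rightarrow> real"
  assumes fin: "finite I" and ne: "I \<noteq> {}"
  obtains x where "(\<Sum>i\<in>I. (x i)\<^sup>2) = 1"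
    and "\<And>y. (\<Sum>i\<in>I. (y i)\<^sup>2) = 1 \<Longrightarrow> bilin I a y y \<le> bilin I a x x"
proof -
  define K :: "('i \<Rightarrow> real) set" where "K = PiE UNIV (\<lambda>i. if i \<in> I then {-1..1} else {0})"
  define S where "S = K \<inter> {x. (\<Sum>i\<in>I. (x i)\<^sup>2) = 1}"
  have "compactin (product_topology (\<lambda>_. euclidean) UNIV) K"
    unfolding K_def by (subst compactin_PiE) auto
  then have "compact K"
    by (simp add: euclidean_product_topology)
  moreover have "closed {x :: 'i \<Rightarrow> real. (\<Sum>i\<in>I. (x i)\<^sup>2) = 1}"
    by (intro closed_Collect_eq continuous_intros continuous_on_product_coordinates)
  ultimately have "compact S"
    unfolding S_def by (rule compact_Int_closed)
  have inS: "(\<lambda>i. if i \<in> I then y i else 0) \<in> S" if y: "(\<Sum>i\<in>I. (y i)\<^sup>2) = 1" for y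
  proof -
    have "\<bar>y i\<bar> \<le> 1" if "i \<in> I" for i
      using member_le_sum[of i I "\<lambda>i. (y i)\<^sup>2"] fin that y by (simp add: abs_square_le_1)
    then show ?thesis
      using y by (auto simp: S_def K_def PiE_iff abs_le_iff minus_le_iff cong: sum.cong)
  qed
  obtain i0 where "i0 \<in> I" using ne by blast
  then have "(\<Sum>i\<in>I. (if i = i0 then 1 else 0 :: real)\<^sup>2) = 1"
    using fin by (simp add: if_distrib[of "\<lambda>x. x\<^sup>2"] cong: if_cong)
  from inS[OF this] have "S \<noteq> {}" by blast
  have "continuous_on S (\<lambda>x. bilin I a x x)"
    unfolding bilin_def
    by (intro continuous_intros continuous_on_subset[OF continuous_on_product_coordinates]) auto
  from continuous_attains_sup[OF \<open>compact S\<close> \<open>S \<noteq> {}\<close> this]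
  obtain x where "x \<in> S" and max: "\<And>y. y \<in> S \<Longrightarrow> bilin I a y y \<le> bilin I a x x"
    by blast
  show thesis
  proof
    show "(\<Sum>i\<in>I. (x i)\<^sup>2) = 1" using \<open>x \<in> S\<close> by (simp add: S_def)
    show "bilin I a y y \<le> bilin I a x x" if "(\<Sum>i\<in>I. (y i)\<^sup>2) = 1" for y
      using max[OF inS[OF that]] by (simp add: bilin_def cong: sum.cong)
  qed
qed

text \<open>Both sides are homogeneous of degree two, so it suffices to scale \<open>y\<close> to the unit sphere.\<close>

lemma quadratic_form_le_max:
  assumes "finite I"
    and max: "\<And>y. (\<Sum>i\<in>I. (y i)\<^sup>2) = 1 \<Longrightarrow> bilin I a y y \<le> l"
  shows "bilin I a y y \<le> l * (\<Sum>i\<in>I. (y i)\<^sup>2)"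
proof (cases "(\<Sum>i\<in>I. (y i)\<^sup>2) = 0")
  case True
  then have "y i = 0" if "i \<in> I" for i
    using that \<open>finite I\<close> by (simp add: sum_nonneg_eq_0_iff)
  then show ?thesis by (simp add: bilin_def cong: sum.cong)
next
  case False
  define s where "s = (\<Sum>i\<in>I. (y i)\<^sup>2)"
  have s: "s > 0" using False by (simp add: s_def sum_nonneg less_le)
  have "(\<Sum>i\<in>I. (y i / sqrt s)\<^sup>2) = s / s"
    using s by (simp add: power_divide s_def flip: sum_divide_distrib)
  then have "(\<Sum>i\<in>I. (y i / sqrt s)\<^sup>2) = 1"
    using s by simp
  from max[OF this] have "bilin I a (\<lambda>i. y i / sqrt s) (\<lambda>i. y i / sqrt s) \<le> l" .
  also have "bilin I a (\<lambda>i. y i / sqrt s) (\<lambda>i. y i / sqrt s) = bilin I a y y / s"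
    using s by (simp add: bilin_def sum_divide_distrib)
  finally show ?thesis
    using s by (simp add: s_def[symmetric] field_simps)
qed

text \<open>First-order condition at a maximiser \<open>x\<close>, without differentiation: moving from \<open>x\<close> in the
  direction of the residual \<open>r = A x - l x\<close> by a small step \<open>t > 0\<close> changes \<open>y \<bullet> A y - l (y \<bullet> y)\<close> by
  \<open>2 t (r \<bullet> r)\<close> up to a term of order \<open>t\<^sup>2\<close>. This difference is never positive, hence \<open>r = 0\<close>.\<close>

lemma quadratic_form_max_is_eigenvector:
  assumes "finite I"
    and sym: "\<And>i j. i \<in> I \<Longrightarrow> j \<in> I \<Longrightarrow> a i j = a j i"
    and bound: "\<And>y. bilin I a y y \<le> l * (\<Sum>i\<in>I. (y i)\<^sup>2)"
    and eq: "bilin I a x x = l * (\<Sum>i\<in>I. (x i)\<^sup>2)"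
    and "i \<in> I"
  shows "(\<Sum>j\<in>I. a i j * x j) = l * x i"
proof -
  define r where "r i = (\<Sum>j\<in>I. a i j * x j) - l * x i" for i
  define s where "s = (\<Sum>i\<in>I. (r i)\<^sup>2)"
  define c where "c = bilin I a r r - l * s"
  have s_eq: "s = bilin I a r x - l * (\<Sum>i\<in>I. r i * x i)"
  proof -
    have "s = (\<Sum>i\<in>I. r i * ((\<Sum>j\<in>I. a i j * x j) - l * x i))"
      by (simp add: s_def power2_eq_square r_def)
    then show ?thesis
      by (simp add: bilin_eq_row right_diff_distrib sum_subtractf sum_distrib_left mult_ac)
  qed
  have quad: "2 * t * s + t\<^sup>2 * c \<le> 0" for t
  proof -
    have "(\<Sum>i\<in>I. (x i + t * r i)\<^sup>2) = (\<Sum>i\<in>I. (x i)\<^sup>2) + 2 * t * (\<Sum>i\<in>I. r i * x i) + t\<^sup>2 * s"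
      by (simp add: s_def power2_sum power_mult_distrib sum.distrib sum_distrib_left mult_ac)
    moreover have "2 * t * s = 2 * t * bilin I a r x - 2 * t * l * (\<Sum>i\<in>I. r i * x i)"
      by (subst s_eq) (simp add: algebra_simps)
    moreover have "bilin I a (\<lambda>i. x i + t * r i) (\<lambda>i. x i + t * r i)
        = bilin I a x x + 2 * t * bilin I a r x + t\<^sup>2 * bilin I a r r"
      using sym by (rule bilin_perturb)
    ultimately show ?thesis
      using bound[of "\<lambda>i. x i + t * r i"] eq by (simp add: c_def algebra_simps)
  qed
  have "s \<ge> 0" by (simp add: s_def sum_nonneg)
  have "s = 0"
  proof (rule ccontr)
    assume "s \<noteq> 0"
    with \<open>s \<ge> 0\<close> have "s > 0" by simp
    \<comment> \<open>A step so short that the linear term dominates the quadratic one; the summand 1 keeps the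
      denominator positive when \<open>c = 0\<close>.\<close>
    define t where "t = s / (1 + \<bar>c\<bar>)"
    have "t > 0" using \<open>s > 0\<close> by (simp add: t_def)
    have "t * (1 + \<bar>c\<bar>) = s" by (simp add: t_def)
    then have "t * \<bar>c\<bar> < s" using \<open>t > 0\<close> by (simp add: algebra_simps)
    moreover have "- (t * \<bar>c\<bar>) \<le> t * c"
      using \<open>t > 0\<close> by (metis abs_le_D2 abs_mult abs_of_pos minus_le_iff order_refl)
    ultimately have "0 < 2 * s + t * c" using \<open>s > 0\<close> by linarith
    then have "0 < t * (2 * s + t * c)" using \<open>t > 0\<close> by simp
    then show False using quad[of t] by (simp add: algebra_simps power2_eq_square)
  qed
  then have "r i = 0"
    using \<open>finite I\<close> \<open>i \<in> I\<close> by (simp add: s_def sum_nonneg_eq_0_iff)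
  then show ?thesis by (simp add: r_def)
qed

lemma nonneg_form_has_nonneg_top_eigenvector:
  fixes a :: "'i \<Rightarrow> 'i \<Rightarrow> real"
  assumes fin: "finite I" and ne: "I \<noteq> {}"
    and sym: "\<forall>i\<in>I. \<forall>j\<in>I. a i j = a j i"
    and nonneg: "\<forall>i\<in>I. \<forall>j\<in>I. 0 \<le> a i j"
  obtains x l where "\<forall>i. 0 \<le> x i" and "\<exists>i\<in>I. 0 < x i"
    and "\<forall>i\<in>I. (\<Sum>j\<in>I. a i j * x j) = l * x i"
    and "\<forall>y. bilin I a y y \<le> l * (\<Sum>i\<in>I. (y i)\<^sup>2)"
proof -
  obtain z where z: "(\<Sum>i\<in>I. (z i)\<^sup>2) = 1"
    and max: "\<And>y. (\<Sum>i\<in>I. (y i)\<^sup>2) = 1 \<Longrightarrow> bilin I a y y \<le> bilin I a z z"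
    using quadratic_form_attains_max[OF fin ne] by blast
  define x where "x i = \<bar>z i\<bar>" for i
  define l where "l = bilin I a z z"
  have x: "(\<Sum>i\<in>I. (x i)\<^sup>2) = 1" using z by (simp add: x_def)
  have bound: "bilin I a y y \<le> l * (\<Sum>i\<in>I. (y i)\<^sup>2)" for y
    unfolding l_def by (rule quadratic_form_le_max[OF fin max])
  \<comment> \<open>Each summand is at most its absolute value, in which \<open>a i j\<close> is unchanged as it is nonnegative.\<close>
  have "bilin I a z z \<le> bilin I a x x"
    unfolding bilin_def x_def
  proof (intro sum_mono)
    fix i j assume "i \<in> I" "j \<in> I"
    then show "a i j * z i * z j \<le> a i j * \<bar>z i\<bar> * \<bar>z j\<bar>"
      using nonneg[rule_format, of i j] abs_ge_self[of "a i j * z i * z j"] by (simp add: abs_mult)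
  qed
  with max[OF x] have "bilin I a x x = l * (\<Sum>i\<in>I. (x i)\<^sup>2)"
    by (simp add: x l_def)
  then have eig: "\<forall>i\<in>I. (\<Sum>j\<in>I. a i j * x j) = l * x i"
    using quadratic_form_max_is_eigenvector[of I a l x] fin sym bound by simp
  have "\<exists>i\<in>I. x i \<noteq> 0"
  proof (rule ccontr)
    assume "\<not> (\<exists>i\<in>I. x i \<noteq> 0)"
    then have "(\<Sum>i\<in>I. (x i)\<^sup>2) = 0" by simp
    with x show False by simp
  qed
  then have pos: "\<exists>i\<in>I. 0 < x i" by (auto simp: x_def)
  show thesis
    by (rule that[OF _ pos eig]) (simp_all add: x_def bound)
qed

section \<open>Eigenvalues of a nonnegative symmetric matrix\<close>

lemma symmetric_nonneg_mat_top_eigenvector: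
  assumes "0 < n" and A: "A \<in> carrier_mat n n"
    and "nonneg_mat A" and "symmetric_mat A"
  obtains v l where "eigenvector A v l" and "\<forall>i<n. 0 \<le> v $ i"
    and "\<forall>m. eigenvalue A m \<longrightarrow> m \<le> l"
proof -
  define a where "a i j = A $$ (i, j)" for i j
  have sym: "\<forall>i\<in>{..<n}. \<forall>j\<in>{..<n}. a i j = a j i"
    using \<open>symmetric_mat A\<close> A unfolding symmetric_mat_def a_def
    by (metis carrier_matD index_transpose_mat(1) lessThan_iff)
  have nonneg: "\<forall>i\<in>{..<n}. \<forall>j\<in>{..<n}. 0 \<le> a i j"
    using \<open>nonneg_mat A\<close> A by (simp add: nonneg_mat_def a_def)
  have ne: "{..<n} \<noteq> {}" using \<open>0 < n\<close> by (simp add: lessThan_empty_iff)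
  obtain x l where x: "\<forall>i. 0 \<le> x i" "\<exists>i\<in>{..<n}. 0 < x i"
    and eig: "\<forall>i\<in>{..<n}. (\<Sum>j<n. a i j * x j) = l * x i"
    and bound: "\<forall>y. bilin {..<n} a y y \<le> l * (\<Sum>i<n. (y i)\<^sup>2)"
    by (rule nonneg_form_has_nonneg_top_eigenvector[OF finite_lessThan ne sym nonneg])
  have mult: "(A *\<^sub>v v) $ i = (\<Sum>j<n. a i j * v $ j)" if "i < n" "v \<in> carrier_vec n" for v i
    using that A by (simp add: scalar_prod_def a_def atLeast0LessThan)
  show thesis
  proof
    show "eigenvector A (vec n x) l"
      unfolding eigenvector_def
    proof (intro conjI)
      show "vec n x \<in> carrier_vec (dim_row A)" using A by simp
      show "vec n x \<noteq> 0\<^sub>v (dim_row A)"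
        using x(2) A by (auto simp: vec_eq_iff)
      show "A *\<^sub>v vec n x = l \<cdot>\<^sub>v vec n x"
        using A eig by (intro eq_vecI) (simp_all add: mult del: index_mult_mat_vec)
    qed
    show "\<forall>i<n. 0 \<le> vec n x $ i"
      using x(1) by simp
    show "\<forall>m. eigenvalue A m \<longrightarrow> m \<le> l"
    proof (intro allI impI)
      fix m assume "eigenvalue A m"
      then obtain v where v: "v \<in> carrier_vec n" "v \<noteq> 0\<^sub>v n" "A *\<^sub>v v = m \<cdot>\<^sub>v v"
        using A by (auto simp: eigenvalue_def eigenvector_def)
      have "(\<Sum>j<n. a i j * v $ j) = m * v $ i" if "i < n" for i
        using mult[OF that v(1)] v that by simp
      then have "bilin {..<n} a (($) v) (($) v) = m * (\<Sum>i<n. (v $ i)\<^sup>2)"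
        by (simp add: bilin_eq_row sum_distrib_left power2_eq_square mult_ac)
      with bound[rule_format, of "($) v"]
      have le: "m * (\<Sum>i<n. (v $ i)\<^sup>2) \<le> l * (\<Sum>i<n. (v $ i)\<^sup>2)" by simp
      have "(\<Sum>i<n. (v $ i)\<^sup>2) \<noteq> 0"
        using v(1,2) by (auto simp: sum_nonneg_eq_0_iff vec_eq_iff)
      then have "(\<Sum>i<n. (v $ i)\<^sup>2) > 0"
        by (simp add: sum_nonneg less_le)
      with le show "m \<le> l" by simp
    qed
  qed
qed

section \<open>The quotient by an equitable partition\<close>

text \<open>Submatrices are indexed through the increasing enumeration \<open>pick\<close> of their index sets; this
  bijection turns their row sums back into sums over the index sets themselves.\<close>

lemma bij_betw_pick:
  assumes "finite J"
  shows "bij_betw (pick J) {..<card J} J"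
proof -
  have inj: "inj_on (pick J) {..<card J}"
    by (rule linorder_inj_onI') (use pick_mono_le in \<open>fastforce\<close>)
  have "pick J ` {..<card J} \<subseteq> J"
    using pick_in_set_le by auto
  then have "pick J ` {..<card J} = J"
    using assms by (intro card_subset_eq) (simp_all add: card_image[OF inj])
  with inj show ?thesis
    by (simp add: bij_betw_def)
qed

lemma regular_submatrix_row_sum:
  assumes "A \<in> carrier_mat m n" "I \<subseteq> {..<m}" "J \<subseteq> {..<n}"
    and "regular_mat (submatrix A I J)"
  obtains r where "\<And>i. i \<in> I \<Longrightarrow> (\<Sum>j\<in>J. A $$ (i, j)) = r"
proof -
  have I: "{i. i < dim_row A \<and> i \<in> I} = I" and J: "{j. j < dim_col A \<and> j \<in> J} = J"
    using assms(1-3) by auto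
  have fin: "finite I" "finite J"
    using assms(2,3) finite_subset by auto
  from assms(4) obtain r where
    r: "\<And>i. i < card I \<Longrightarrow> (\<Sum>j<card J. submatrix A I J $$ (i, j)) = r"
    unfolding regular_mat_def dim_submatrix I J by blast
  have "(\<Sum>j\<in>J. A $$ (i, j)) = r" if "i \<in> I" for i
  proof -
    obtain i' where i': "i' < card I" "i = pick I i'"
      using bij_betw_pick[OF fin(1)] \<open>i \<in> I\<close> by (auto simp: bij_betw_def)
    have "(\<Sum>j\<in>J. A $$ (i, j)) = (\<Sum>j<card J. A $$ (i, pick J j))"
      by (rule sum.reindex_bij_betw[OF bij_betw_pick[OF fin(2)], symmetric])
    also have "\<dots> = (\<Sum>j<card J. submatrix A I J $$ (i', j))"
      using i' by (intro sum.cong refl) (simp add: submatrix_index I J)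
    finally show ?thesis using r[OF i'(1)] by simp
  qed
  then show thesis by (rule that)
qed

text \<open>The normalised characteristic matrix of a partition. The scaling makes its columns
  orthonormal.\<close>

definition part_mat :: "nat \<Rightarrow> nat set list \<Rightarrow> real mat" where
  "part_mat n Ps = mat n (length Ps)
     (\<lambda>(i, p). if i \<in> Ps ! p then 1 / sqrt (card (Ps ! p)) else 0)"

lemma part_mat_carrier: "part_mat n Ps \<in> carrier_mat n (length Ps)"
  by (simp add: part_mat_def)

lemma is_partition_part:
  assumes "is_partition n Ps" "p < length Ps"
  shows "Ps ! p \<subseteq> {..<n}" "finite (Ps ! p)" "card (Ps ! p) > 0"
proof -
  have "Ps ! p \<in> set Ps" using assms(2) by simp
  then have *: "Ps ! p \<subseteq> {..<n}" "Ps ! p \<noteq> {}"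
    using assms(1) by (auto simp: is_partition_def partition_on_def)
  show "Ps ! p \<subseteq> {..<n}" by fact
  show "finite (Ps ! p)" using * finite_subset by auto
  with * show "card (Ps ! p) > 0" by (simp add: card_gt_0_iff)
qed

lemma is_partition_obtain_part:
  assumes "is_partition n Ps" "i < n"
  obtains p where "p < length Ps" "i \<in> Ps ! p"
  using assms unfolding is_partition_def partition_on_def
  by (metis UnionE in_set_conv_nth lessThan_iff)

lemma is_partition_part_unique:
  assumes "is_partition n Ps" "p < length Ps" "q < length Ps" "i \<in> Ps ! p" "i \<in> Ps ! q"
  shows "p = q"
proof -
  have "Ps ! p = Ps ! q"
    using assms unfolding is_partition_def partition_on_def disjoint_def
    by (metis IntI empty_iff nth_mem)
  then show ?thesis
    using assms by (simp add: is_partition_def nth_eq_iff_index_eq)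
qed

text \<open>Row \<open>i\<close> has a single nonzero entry, in the column of the part that contains \<open>i\<close>.\<close>

lemma part_mat_row_sum:
  assumes "is_partition n Ps" "q < length Ps" "i \<in> Ps ! q"
  shows "(\<Sum>p<length Ps. part_mat n Ps $$ (i, p) * f p) = f q / sqrt (card (Ps ! q))"
proof -
  have "i < n" using is_partition_part(1)[OF assms(1,2)] assms(3) by auto
  have "(\<Sum>p<length Ps. part_mat n Ps $$ (i, p) * f p)
      = (\<Sum>p<length Ps. if p = q then f q / sqrt (card (Ps ! q)) else 0)"
    using \<open>i < n\<close> assms is_partition_part_unique[OF assms(1)]
    by (intro sum.cong refl) (auto simp: part_mat_def)
  then show ?thesis using assms(2) by simp
qed

lemma part_mat_col_sum:
  assumes "is_partition n Ps" "p < length Ps"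
  shows "(\<Sum>i<n. f i * part_mat n Ps $$ (i, p)) = (\<Sum>i\<in>Ps ! p. f i) / sqrt (card (Ps ! p))"
proof -
  have "(\<Sum>i<n. f i * part_mat n Ps $$ (i, p))
      = (\<Sum>i<n. if i \<in> Ps ! p then f i / sqrt (card (Ps ! p)) else 0)"
    using assms(2) by (intro sum.cong refl) (auto simp: part_mat_def)
  also have "\<dots> = (\<Sum>i\<in>Ps ! p. f i / sqrt (card (Ps ! p)))"
    using is_partition_part(1)[OF assms]
    by (simp add: sum.inter_restrict[symmetric] Int_absorb1)
  finally show ?thesis by (simp add: sum_divide_distrib)
qed

lemma quotient_mat_carrier: "quotient_mat A Ps Qs \<in> carrier_mat (length Ps) (length Qs)"
  by (simp add: quotient_mat_def)

text \<open>For \<open>i\<close> in the part \<open>P\<close>, let \<open>r\<close> be the common row sum of \<open>A[P, Q]\<close>. The entry of the left-hand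
  side at \<open>(i, Q)\<close> is \<open>r / \<surd>|Q|\<close>. On the right-hand side only the row \<open>P\<close> of the quotient
  contributes; its entry is \<open>|P| r / \<surd>(|P| |Q|)\<close>, and the factor \<open>1 / \<surd>|P|\<close> from \<open>part_mat\<close> turns
  this into the same number.\<close>

lemma equitable_intertwines:
  fixes A :: "real mat"
  assumes A: "A \<in> carrier_mat m n"
    and Ps: "is_partition m Ps" and Qs: "is_partition n Qs" and eq: "equitable A Ps Qs"
  shows "A * part_mat n Qs = part_mat m Ps * quotient_mat A Ps Qs"
proof (rule eq_matI)
  fix i q assume "i < dim_row (part_mat m Ps * quotient_mat A Ps Qs)"
    and "q < dim_col (part_mat m Ps * quotient_mat A Ps Qs)"
  then have "i < m" and q: "q < length Qs"
    by (simp_all add: part_mat_def quotient_mat_def)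
  obtain p where p: "p < length Ps" "i \<in> Ps ! p"
    using is_partition_obtain_part[OF Ps \<open>i < m\<close>] .
  have "regular_mat (submatrix A (Ps ! p) (Qs ! q))"
    using eq p q by (simp add: equitable_def)
  from regular_submatrix_row_sum[OF A is_partition_part(1)[OF Ps p(1)]
      is_partition_part(1)[OF Qs q] this]
  obtain r where r: "\<And>i. i \<in> Ps ! p \<Longrightarrow> (\<Sum>j\<in>Qs ! q. A $$ (i, j)) = r"
    by blast
  have "(A * part_mat n Qs) $$ (i, q) = (\<Sum>j<n. A $$ (i, j) * part_mat n Qs $$ (j, q))"
    using A \<open>i < m\<close> q
    by (simp add: scalar_prod_def atLeast0LessThan part_mat_def)
  also have "\<dots> = r / sqrt (card (Qs ! q))"
    using r[OF p(2)] by (simp add: part_mat_col_sum[OF Qs q])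
  also have "\<dots> = quotient_mat A Ps Qs $$ (p, q) / sqrt (card (Ps ! p))"
  proof -
    have "quotient_mat A Ps Qs $$ (p, q)
        = card (Ps ! p) * r / (sqrt (card (Ps ! p)) * sqrt (card (Qs ! q)))"
      using p q r by (simp add: quotient_mat_def real_sqrt_mult)
    also have "\<dots> = sqrt (card (Ps ! p)) * r / sqrt (card (Qs ! q))"
      by (simp add: real_div_sqrt flip: times_divide_times_eq)
    finally show ?thesis
      using is_partition_part(3)[OF Ps p(1)] by simp
  qed
  also have "\<dots> = (\<Sum>p'<length Ps. part_mat m Ps $$ (i, p') * quotient_mat A Ps Qs $$ (p', q))"
    by (rule part_mat_row_sum[OF Ps p, symmetric])
  also have "\<dots> = (part_mat m Ps * quotient_mat A Ps Qs) $$ (i, q)"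
    using \<open>i < m\<close> q
    by (simp add: scalar_prod_def atLeast0LessThan part_mat_def quotient_mat_def)
  finally show "(A * part_mat n Qs) $$ (i, q) = (part_mat m Ps * quotient_mat A Ps Qs) $$ (i, q)" .
qed (use A in \<open>simp_all add: part_mat_def quotient_mat_def\<close>)

lemma quotient_mat_symmetric:
  assumes "symmetric_mat A" "A \<in> carrier_mat n n" "is_partition n Ps"
  shows "symmetric_mat (quotient_mat A Ps Ps)"
proof -
  have sym: "A $$ (i, j) = A $$ (j, i)" if "i < n" "j < n" for i j
    using assms(1,2) that unfolding symmetric_mat_def
    by (metis carrier_matD index_transpose_mat(1))
  have "(\<Sum>i\<in>Ps ! q. \<Sum>j\<in>Ps ! p. A $$ (i, j)) = (\<Sum>i\<in>Ps ! p. \<Sum>j\<in>Ps ! q. A $$ (i, j))"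
    if "p < length Ps" "q < length Ps" for p q
    using is_partition_part(1)[OF assms(3)] that
    by (subst sum.swap) (intro sum.cong refl sym, auto)
  then show ?thesis
    unfolding symmetric_mat_def
    by (intro eq_matI) (auto simp: quotient_mat_def mult.commute)
qed

text \<open>Each \<open>y p\<close> can be read off, up to a positive factor, at any index in the part \<open>p\<close>; this is
  where parts being nonempty matters.\<close>

lemma part_mat_mult_nonzero:
  assumes Ps: "is_partition n Ps" and y: "y \<in> carrier_vec (length Ps)" "y \<noteq> 0\<^sub>v (length Ps)"
  shows "part_mat n Ps *\<^sub>v y \<noteq> 0\<^sub>v n"
proof
  assume zero: "part_mat n Ps *\<^sub>v y = 0\<^sub>v n"
  obtain p where p: "p < length Ps" "y $ p \<noteq> 0"
    using y by (auto simp: vec_eq_iff)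
  obtain i where i: "i \<in> Ps ! p"
    using is_partition_part(3)[OF Ps p(1)] by (auto simp: card_gt_0_iff)
  then have "i < n" using is_partition_part(1)[OF Ps p(1)] by auto
  then have "(part_mat n Ps *\<^sub>v y) $ i = (\<Sum>p<length Ps. part_mat n Ps $$ (i, p) * y $ p)"
    using y by (simp add: scalar_prod_def atLeast0LessThan part_mat_def)
  also have "\<dots> = y $ p / sqrt (card (Ps ! p))"
    by (rule part_mat_row_sum[OF Ps p(1) i])
  finally show False
    using zero \<open>i < n\<close> p is_partition_part(3)[OF Ps p(1)] by simp
qed

text \<open>Nonnegativity rules out cancellation: if all sums of \<open>x\<close> over the parts vanish, then so does
  \<open>x\<close>.\<close>

lemma part_mat_transpose_mult_nonzero:
  assumes Ps: "is_partition n Ps" and x: "x \<in> carrier_vec n" "x \<noteq> 0\<^sub>v n"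
    and nonneg: "\<forall>i<n. 0 \<le> x $ i"
  shows "transpose_mat (part_mat n Ps) *\<^sub>v x \<noteq> 0\<^sub>v (length Ps)"
proof
  assume zero: "transpose_mat (part_mat n Ps) *\<^sub>v x = 0\<^sub>v (length Ps)"
  obtain i where i: "i < n" "x $ i \<noteq> 0"
    using x by (auto simp: vec_eq_iff)
  obtain p where p: "p < length Ps" "i \<in> Ps ! p"
    using is_partition_obtain_part[OF Ps i(1)] .
  have sub: "Ps ! p \<subseteq> {..<n}" and fin: "finite (Ps ! p)"
    using is_partition_part[OF Ps p(1)] by auto
  have "(transpose_mat (part_mat n Ps) *\<^sub>v x) $ p = (\<Sum>j<n. x $ j * part_mat n Ps $$ (j, p))"
    using x p by (simp add: scalar_prod_def atLeast0LessThan part_mat_def mult.commute)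
  also have "\<dots> = (\<Sum>j\<in>Ps ! p. x $ j) / sqrt (card (Ps ! p))"
    by (rule part_mat_col_sum[OF Ps p(1)])
  finally have "(\<Sum>j\<in>Ps ! p. x $ j) = 0"
    using zero p(1) is_partition_part(3)[OF Ps p(1)] by simp
  then have "x $ i = 0"
    using sum_nonneg_eq_0_iff[OF fin, of "($) x"] nonneg sub p(2) by auto
  with i show False by simp
qed

theorem theorem6:
  fixes A :: "real mat" and n :: nat and Ps :: "nat set list"
  assumes "0 < n"
    and "A \<in> carrier_mat n n"
    and "irreducible_mat A"
    and "nonneg_mat A"
    and "symmetric_mat A"
    and "is_partition n Ps"
    and "equitable A Ps Ps"
  shows "largest_eigenvalue A = largest_eigenvalue (quotient_mat A Ps Ps)"
proof -
  define k where "k = length Ps"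
  define B where "B = quotient_mat A Ps Ps"
  define C where "C = part_mat n Ps"
  note A = \<open>A \<in> carrier_mat n n\<close>
  have B: "B \<in> carrier_mat k k" and C: "C \<in> carrier_mat n k"
    by (simp_all add: B_def C_def k_def quotient_mat_carrier part_mat_carrier)
  have C': "transpose_mat C \<in> carrier_mat k n"
    using C by simp
  have AC: "A * C = C * B"
    unfolding B_def C_def using assms by (intro equitable_intertwines)
  have "transpose_mat B = B"
    using quotient_mat_symmetric[OF assms(5) A assms(6)] by (simp add: B_def symmetric_mat_def)
  then have CA: "transpose_mat C * A = B * transpose_mat C"
    using arg_cong[OF AC, of transpose_mat] transpose_mult[OF A C] transpose_mult[OF C B]
      \<open>symmetric_mat A\<close> by (simp add: symmetric_mat_def)
  \<comment> \<open>\<open>A C = C B\<close> lifts eigenvectors of \<open>B\<close>; its transpose projects the top eigenvector of \<open>A\<close>.\<close>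
  have lift: "eigenvalue A m" if "eigenvalue B m" for m
  proof -
    from that obtain y where y: "y \<in> carrier_vec k" "y \<noteq> 0\<^sub>v k" "B *\<^sub>v y = m \<cdot>\<^sub>v y"
      using B by (auto simp: eigenvalue_def eigenvector_def)
    have "A *\<^sub>v (C *\<^sub>v y) = C *\<^sub>v (B *\<^sub>v y)"
      using assoc_mult_mat_vec[OF A C y(1)] assoc_mult_mat_vec[OF C B y(1)] AC by simp
    also have "\<dots> = m \<cdot>\<^sub>v (C *\<^sub>v y)"
      using C y by (simp add: mult_mat_vec)
    finally have "eigenvector A (C *\<^sub>v y) m"
      using A C y part_mat_mult_nonzero[OF assms(6)]
      by (simp add: eigenvector_def C_def k_def mult_mat_vec_carrier[OF part_mat_carrier])
    then show ?thesis by (auto simp: eigenvalue_def)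
  qed
  obtain x l where x: "eigenvector A x l" "\<forall>i<n. 0 \<le> x $ i"
    and top: "\<forall>m. eigenvalue A m \<longrightarrow> m \<le> l"
    by (rule symmetric_nonneg_mat_top_eigenvector[OF assms(1) A assms(4,5)])
  have x': "x \<in> carrier_vec n" "x \<noteq> 0\<^sub>v n" "A *\<^sub>v x = l \<cdot>\<^sub>v x"
    using x(1) A by (auto simp: eigenvector_def)
  have "B *\<^sub>v (transpose_mat C *\<^sub>v x) = transpose_mat C *\<^sub>v (A *\<^sub>v x)"
    using assoc_mult_mat_vec[OF B C' x'(1)] assoc_mult_mat_vec[OF C' A x'(1)] CA by simp
  also have "\<dots> = l \<cdot>\<^sub>v (transpose_mat C *\<^sub>v x)"
    using C x' by (simp add: mult_mat_vec[of _ k n])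
  finally have "eigenvector B (transpose_mat C *\<^sub>v x) l"
    using B C part_mat_transpose_mult_nonzero[OF assms(6) x'(1,2) x(2)]
      mult_mat_vec_carrier[of "transpose_mat C" k n x] x'(1)
    by (simp add: eigenvector_def C_def k_def)
  then have Bl: "eigenvalue B l" by (auto simp: eigenvalue_def)
  have "Max {m. eigenvalue A m} = l"
    using card_finite_spectrum(1)[OF A] top lift[OF Bl]
    by (intro Max_eqI) (auto simp: spectrum_def)
  moreover have "Max {m. eigenvalue B m} = l"
    using card_finite_spectrum(1)[OF B] top lift Bl
    by (intro Max_eqI) (auto simp: spectrum_def)
  ultimately show ?thesis
    by (simp add: largest_eigenvalue_def B_def)
qed

end
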